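(* Let $\mathcal{F}(\lambda,\rho)$ be the fixed-form ELBO and $\mathcal{L}(\lambda)$ the locally maximised ELBO (LM-ELBO) defined in the context, and for each $\lambda$ let $\rho^*(\lambda)$ be a parameter value with $q(\theta;\rho^*(\lambda))=q^*_\lambda(\theta)$. If $\lambda^*$ is a global maximiser, a local maximiser, or a stationary point of $\mathcal{L}(\lambda)$, then $[\lambda^*,\rho^*(\lambda^* )]$ is, respectively, a global maximiser, a local maximiser, or a stationary point of $\mathcal{F}(\lambda,\rho)$. In the stationary-point case, the derivatives involved are assumed to exist; a stationary point of $\mathcal{L}$ means $\nabla_\lambda\mathcal{L}(\lambda)|_{\lambda=\lambda^*}=0$, and a stationary point of $\mathcal{F}$ means that both $\nabla_\lambda\mathcal{F}$ and $\nabla_\rho\mathcal{F}$ vanish at $[\lambda^*,\rho^*(\lambda^* )]$.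
   Context: Setting (mean-field variational inference). $X$ and $\theta$ are disjoint multivariate unknown variables and $Y$ denotes the given measurements. The posterior is known up to a constant: $p(X,\theta|Y)\propto f(X,\theta,Y)$, where the unnormalised posterior $f$ is pointwise computable. The variational distributions $q(X;\lambda)$ and $q(\theta;\rho)$ have assumed parametric forms governed by the parameter vectors $\lambda$ and $\rho$ respectively. Fixed-form ELBO: $$\mathcal{F}(\lambda,\rho)=\mathrm{E}_{q(X;\lambda)q(\theta;\rho)}\log\frac{f(X,\theta,Y)}{q(X;\lambda)\,q(\theta;\rho)}.$$ For each $\lambda$ let $q^*_\lambda(\theta)$ be the probability distribution $$q^*_\lambda(\theta)\propto\exp\big(\mathrm{E}_{q(X;\lambda)}\log f(X,\theta,Y)\big).$$ LM-ELBO: $$\mathcal{L}(\lambda)=\mathrm{E}_{q(X;\lambda)q^*_\lambda(\theta)}\log\frac{f(X,\theta,Y)}{q(X;\lambda)\,q^*_\lambda(\theta)}.$$ Standing assumption: the optimal distribution $q^*_\lambda(\theta)$ is a member of the assumed distributional class $q(\theta;\rho)$, and $\rho^*(\lambda)$ denotes the parameter value (or any of the values) that reproduces it with $\lambda$ held fixed, i.e. $q(\theta;\rho^*(\lambda))=q^*_\lambda(\theta)$. *)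

theory Defs
  imports "HOL-Analysis.Analysis"
begin

section \<open>Extended-real logarithm, exponential and expectation\<close>

text \<open>
  An ELBO has the form (log of a constant) minus a Kullback--Leibler divergence, so it may
  legitimately be \<open>-\<infinity>\<close>; likewise \<open>log f\<close> is \<open>-\<infinity>\<close> where \<open>f\<close> vanishes.  Everything is therefore
  \<^typ>\<open>ereal\<close>-valued, which avoids both \<open>ln 0 = 0\<close> and the value \<open>0\<close> of a Bochner integral
  that does not exist.
\<close>

definition eln :: "real \<Rightarrow> ereal" where
  "eln x = (if 0 < x then ereal (ln x) else -\<infinity>)"

fun eexp :: "ereal \<Rightarrow> ennreal" where
  "eexp (ereal r) = ennreal (exp r)"
| "eexp PInfty = \<infinity>"
| "eexp MInfty = 0"

text \<open>
  The expectation is meaningful only when \<open>expectation_defined\<close> holds; otherwise its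
  value is that of \<open>\<infinity> - \<infinity>\<close> on \<^typ>\<open>ereal\<close>.
\<close>

definition expectation_defined :: "'a measure \<Rightarrow> ('a \<Rightarrow> ereal) \<Rightarrow> bool" where
  "expectation_defined M h \<longleftrightarrow>
     (\<integral>\<^sup>+ x. e2ennreal (h x) \<partial>M) < \<infinity> \<or> (\<integral>\<^sup>+ x. e2ennreal (- h x) \<partial>M) < \<infinity>"

definition eexpectation :: "'a measure \<Rightarrow> ('a \<Rightarrow> ereal) \<Rightarrow> ereal" where
  "eexpectation M h =
     enn2ereal (\<integral>\<^sup>+ x. e2ennreal (h x) \<partial>M) - enn2ereal (\<integral>\<^sup>+ x. e2ennreal (- h x) \<partial>M)"

section \<open>Densities\<close>

text \<open>
  Distributions of \<open>X\<close> and \<open>\<theta>\<close> are given by real densities with respect to base measures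
  (e.g. Lebesgue or counting measure).
\<close>

definition probability_density :: "'a measure \<Rightarrow> ('a \<Rightarrow> real) \<Rightarrow> bool" where
  "probability_density M p \<longleftrightarrow>
     p \<in> borel_measurable M \<and> (\<forall>x\<in>space M. 0 \<le> p x) \<and> (\<integral>\<^sup>+ x. ennreal (p x) \<partial>M) = 1"

text \<open>
  The posterior density \<open>p(X,\<theta>|Y)\<close> is \<open>f(X,\<theta>,Y)\<close> divided by its integral over
  \<open>(X,\<theta>)\<close>, so that integral has to be positive and finite.
\<close>

definition unnormalised_posterior ::
  "'x measure \<Rightarrow> 't measure \<Rightarrow> ('x \<Rightarrow> 't \<Rightarrow> 'y \<Rightarrow> real) \<Rightarrow> 'y \<Rightarrow> bool" where
  "unnormalised_posterior MX MT f Y \<longleftrightarrow>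
     (\<lambda>(x, t). f x t Y) \<in> borel_measurable (MX \<Otimes>\<^sub>M MT) \<and>
     (\<forall>x\<in>space MX. \<forall>t\<in>space MT. 0 \<le> f x t Y) \<and>
     0 < (\<integral>\<^sup>+ z. ennreal (f (fst z) (snd z) Y) \<partial>(MX \<Otimes>\<^sub>M MT)) \<and>
     (\<integral>\<^sup>+ z. ennreal (f (fst z) (snd z) Y) \<partial>(MX \<Otimes>\<^sub>M MT)) < \<infinity>"

section \<open>The optimal distribution of \<open>\<theta>\<close>\<close>

text \<open>Here \<open>qx\<close> stands for the density \<open>q(X;\<lambda>)\<close>.\<close>

definition qstar_weight ::
  "'x measure \<Rightarrow> ('x \<Rightarrow> 't \<Rightarrow> 'y \<Rightarrow> real) \<Rightarrow> 'y \<Rightarrow> ('x \<Rightarrow> real) \<Rightarrow> 't \<Rightarrow> ennreal" where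
  "qstar_weight MX f Y qx t = eexp (eexpectation (density MX (\<lambda>x. ennreal (qx x))) (\<lambda>x. eln (f x t Y)))"

definition qstar ::
  "'x measure \<Rightarrow> 't measure \<Rightarrow> ('x \<Rightarrow> 't \<Rightarrow> 'y \<Rightarrow> real) \<Rightarrow> 'y \<Rightarrow> ('x \<Rightarrow> real) \<Rightarrow> 't \<Rightarrow> real" where
  "qstar MX MT f Y qx t =
     enn2real (qstar_weight MX f Y qx t / (\<integral>\<^sup>+ s. qstar_weight MX f Y qx s \<partial>MT))"

definition qstar_exists ::
  "'x measure \<Rightarrow> 't measure \<Rightarrow> ('x \<Rightarrow> 't \<Rightarrow> 'y \<Rightarrow> real) \<Rightarrow> 'y \<Rightarrow> ('x \<Rightarrow> real) \<Rightarrow> bool" where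
  "qstar_exists MX MT f Y qx \<longleftrightarrow>
     (AE t in MT. expectation_defined (density MX (\<lambda>x. ennreal (qx x))) (\<lambda>x. eln (f x t Y))) \<and>
     0 < (\<integral>\<^sup>+ t. qstar_weight MX f Y qx t \<partial>MT) \<and>
     (\<integral>\<^sup>+ t. qstar_weight MX f Y qx t \<partial>MT) < \<infinity>"

section \<open>The two lower bounds\<close>

definition elbo ::
  "'x measure \<Rightarrow> 't measure \<Rightarrow> ('x \<Rightarrow> 't \<Rightarrow> 'y \<Rightarrow> real) \<Rightarrow> 'y \<Rightarrow> ('x \<Rightarrow> real) \<Rightarrow> ('t \<Rightarrow> real) \<Rightarrow> ereal" where
  "elbo MX MT f Y qx qt =
     eexpectation (density MX (\<lambda>x. ennreal (qx x)) \<Otimes>\<^sub>M density MT (\<lambda>t. ennreal (qt t)))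
       (\<lambda>(x, t). eln (f x t Y / (qx x * qt t)))"

definition fixed_form_elbo ::
  "'x measure \<Rightarrow> 't measure \<Rightarrow> ('x \<Rightarrow> 't \<Rightarrow> 'y \<Rightarrow> real) \<Rightarrow> 'y \<Rightarrow>
   ('l \<Rightarrow> 'x \<Rightarrow> real) \<Rightarrow> ('r \<Rightarrow> 't \<Rightarrow> real) \<Rightarrow> 'l \<Rightarrow> 'r \<Rightarrow> ereal" where
  "fixed_form_elbo MX MT f Y qX qT l r = elbo MX MT f Y (qX l) (qT r)"

definition lm_elbo ::
  "'x measure \<Rightarrow> 't measure \<Rightarrow> ('x \<Rightarrow> 't \<Rightarrow> 'y \<Rightarrow> real) \<Rightarrow> 'y \<Rightarrow>
   ('l \<Rightarrow> 'x \<Rightarrow> real) \<Rightarrow> 'l \<Rightarrow> ereal" where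
  "lm_elbo MX MT f Y qX l = elbo MX MT f Y (qX l) (qstar MX MT f Y (qX l))"

section \<open>Maximisers and gradients\<close>

definition global_maximiser :: "('a \<Rightarrow> ereal) \<Rightarrow> 'a set \<Rightarrow> 'a \<Rightarrow> bool" where
  "global_maximiser h S x \<longleftrightarrow> x \<in> S \<and> (\<forall>y\<in>S. h y \<le> h x)"

definition local_maximiser :: "('a::topological_space \<Rightarrow> ereal) \<Rightarrow> 'a set \<Rightarrow> 'a \<Rightarrow> bool" where
  "local_maximiser h S x \<longleftrightarrow> x \<in> S \<and> (\<forall>\<^sub>F y in at x within S. h y \<le> h x)"

text \<open>
  A gradient of an extended-real function on a parameter domain \<open>S\<close> only makes sense at an
  interior point near which the function is finite.
\<close>

definition has_gradient :: "('a::euclidean_space \<Rightarrow> ereal) \<Rightarrow> 'a set \<Rightarrow> 'a \<Rightarrow> 'a \<Rightarrow> bool" where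
  "has_gradient h S x D \<longleftrightarrow>
     x \<in> interior S \<and> (\<forall>\<^sub>F y in nhds x. \<bar>h y\<bar> \<noteq> \<infinity>) \<and> (GDERIV (\<lambda>y. real_of_ereal (h y)) x :> D)"

end

theory Submission
  imports Defs "HOL-Probability.Probability_Measure"
begin

text \<open>
  Write \<open>w(t) = exp (E log f(X,t))\<close> and \<open>Z = \<integral> w\<close>.  By Fubini,
  \<open>F = - E log q(X) + \<integral> q(t) log (w(t) / q(t)) dt\<close>, and by Gibbs' inequality the last integral is
  at most \<open>log Z\<close>, with equality for \<open>q = w / Z\<close>.  Hence \<open>F(\<lambda>,\<rho>) \<le> L(\<lambda>) = F(\<lambda>,\<rho>*(\<lambda>))\<close>.  Maximisers
  of \<open>L\<close> therefore lift to maximisers of \<open>F\<close>; at a stationary point, \<open>F(\<cdot>,\<rho>*(\<lambda>*))\<close> touches \<open>L\<close> from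
  below and so has the same gradient, while \<open>F(\<lambda>*,\<cdot>)\<close> is maximal.

  The splitting of \<open>log (f / (q(X) q(\<theta>)))\<close> is legitimate only when \<open>log q(X)\<close> is integrable.
  Integrability is automatic as soon as some value \<open>F(\<lambda>,\<rho>)\<close> is not \<open>-\<infinity>\<close>; otherwise all of them are \<open>-\<infinity>\<close>
  and there is nothing to prove.  The value \<open>+\<infinity>\<close> is excluded by \<open>log u \<le> u\<close> and \<open>\<integral> f < \<infinity>\<close>.
\<close>

section \<open>Expectations of logarithms\<close>

lemma measurable_eln [measurable]: "eln \<in> borel_measurable borel"
  unfolding eln_def by measurable

lemma eexp_infty [simp]: "eexp \<infinity> = \<infinity>" "eexp (- \<infinity>) = 0"
  by (metis eexp.simps(2) infinity_ereal_def, metis eexp.simps(3) infinity_ereal_def uminus_ereal.simps(2))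

lemma eexp_eq:
  "eexp x = (if x = \<infinity> then \<infinity> else if x = - \<infinity> then 0 else ennreal (exp (real_of_ereal x)))"
  by (cases x) auto

lemma measurable_eexp [measurable]: "eexp \<in> borel_measurable borel"
  unfolding eexp_eq by measurable

lemma e2ennreal_eln: "e2ennreal (eln u) = (if 0 < u then ennreal (ln u) else 0)"
  by (auto simp: eln_def e2ennreal_neg)

lemma e2ennreal_uminus_eln: "e2ennreal (- eln u) = (if 0 < u then ennreal (- ln u) else \<infinity>)"
  by (auto simp: eln_def)

lemma e2ennreal_eln_le: "e2ennreal (eln u) \<le> ennreal (norm u)"
  by (auto simp: e2ennreal_eln intro!: ennreal_leI order_trans[OF ln_bound])

lemma pos_if_pos_divide: "\<lbrakk>0 < a / b; 0 < b\<rbrakk> \<Longrightarrow> 0 < (a :: real)"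
  by (simp add: zero_less_divide_iff)

lemma ln_divide_mult: "\<lbrakk>0 < a; 0 < b; 0 < c\<rbrakk> \<Longrightarrow> ln (a / (b * c)) = ln a - ln b - ln (c :: real)"
  by (simp add: ln_div ln_mult)

text \<open>Bridge to Bochner integrals: where \<open>u\<close> is positive, \<open>eln\<close> and
  \<open>ln\<close> agree, and integrability makes both parts finite.\<close>

lemma eexpectation_eln_eq_integral:
  fixes u :: "'a \<Rightarrow> real"
  assumes int: "integrable M (\<lambda>x. ln (u x))" and pos: "AE x in M. 0 < u x"
  shows "eexpectation M (\<lambda>x. eln (u x)) = ereal (\<integral>x. ln (u x) \<partial>M)"
proof -
  have p: "(\<integral>\<^sup>+x. e2ennreal (eln (u x)) \<partial>M) = (\<integral>\<^sup>+x. ennreal (ln (u x)) \<partial>M)"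
    by (intro nn_integral_cong_AE) (use pos in \<open>auto simp: e2ennreal_eln\<close>)
  have n: "(\<integral>\<^sup>+x. e2ennreal (- eln (u x)) \<partial>M) = (\<integral>\<^sup>+x. ennreal (- ln (u x)) \<partial>M)"
    by (intro nn_integral_cong_AE) (use pos in \<open>auto simp: e2ennreal_uminus_eln\<close>)
  obtain r q where "0 \<le> r" "0 \<le> q" "(\<integral>\<^sup>+x. ennreal (ln (u x)) \<partial>M) = ennreal r"
     "(\<integral>\<^sup>+x. ennreal (- ln (u x)) \<partial>M) = ennreal q"
     "(\<integral>x. ln (u x) \<partial>M) = r - q"
    by (rule integrableE[OF int])
  then show ?thesis
    unfolding eexpectation_def p n by (simp add: enn2ereal_ennreal)
qed

text \<open>On \<open>ereal\<close>, \<open>\<infinity> - \<infinity>\<close> is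
  \<open>\<infinity>\<close>, so an infinite positive part forces the value
  \<open>\<infinity>\<close> whatever the negative part is.\<close>

lemma positive_part_finite_if_eexpectation_neq_PInf:
  assumes "eexpectation M h \<noteq> \<infinity>"
  shows "(\<integral>\<^sup>+ x. e2ennreal (h x) \<partial>M) < \<infinity>"
proof (rule ccontr)
  assume "\<not> ?thesis"
  then have "(\<integral>\<^sup>+ x. e2ennreal (h x) \<partial>M) = \<infinity>" by (simp add: not_less top_unique)
  with assms show False by (simp add: eexpectation_def)
qed

lemma eexpectation_neq_PInf:
  assumes "(\<integral>\<^sup>+ x. e2ennreal (h x) \<partial>M) < \<infinity>"
  shows "eexpectation M h \<noteq> \<infinity>"
proof -
  obtain p where p: "(\<integral>\<^sup>+ x. e2ennreal (h x) \<partial>M) = ennreal p" "0 \<le> p"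
    using assms by (cases "\<integral>\<^sup>+ x. e2ennreal (h x) \<partial>M") auto
  show ?thesis
    unfolding eexpectation_def p(1)
    by (cases "\<integral>\<^sup>+ x. e2ennreal (- h x) \<partial>M") (auto simp: p enn2ereal_ennreal)
qed

text \<open>A finite value makes both parts finite. Since \<open>- eln u\<close> is
  \<open>\<infinity>\<close> where \<open>u\<close> is not positive, that set is null, and off it
  \<open>\<bar>ln u\<bar>\<close> is the sum of the two parts.\<close>

lemma eexpectation_eln_finite_imp:
  fixes u :: "'a \<Rightarrow> real"
  assumes [measurable]: "u \<in> borel_measurable M"
    and fin: "\<bar>eexpectation M (\<lambda>x. eln (u x))\<bar> \<noteq> \<infinity>"
  shows "AE x in M. 0 < u x" and "integrable M (\<lambda>x. ln (u x))"
proof -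
  let ?p = "\<integral>\<^sup>+ x. e2ennreal (eln (u x)) \<partial>M" and ?n = "\<integral>\<^sup>+ x. e2ennreal (- eln (u x)) \<partial>M"
  have p: "?p < \<infinity>"
    using fin by (intro positive_part_finite_if_eexpectation_neq_PInf) auto
  have n: "?n < \<infinity>"
  proof (rule ccontr)
    assume "\<not> ?thesis"
    then have "?n = \<infinity>" by (simp add: not_less top_unique)
    moreover obtain r where "?p = ennreal r" "0 \<le> r"
      using p by (cases ?p) auto
    ultimately show False using fin by (simp add: eexpectation_def enn2ereal_ennreal)
  qed
  have "AE x in M. e2ennreal (- eln (u x)) \<noteq> \<infinity>"
    using n by (intro nn_integral_PInf_AE) auto
  then show pos: "AE x in M. 0 < u x"
    by eventually_elim (auto simp: e2ennreal_uminus_eln split: if_splits)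
  have "(\<integral>\<^sup>+x. ennreal (norm (ln (u x))) \<partial>M)
      = (\<integral>\<^sup>+x. e2ennreal (eln (u x)) + e2ennreal (- eln (u x)) \<partial>M)"
    by (intro nn_integral_cong_AE)
      (use pos in \<open>auto simp: e2ennreal_eln e2ennreal_uminus_eln ennreal_neg abs_if\<close>)
  also have "\<dots> = ?p + ?n"
    by (intro nn_integral_add) auto
  also have "\<dots> < \<infinity>" using p n by simp
  finally show "integrable M (\<lambda>x. ln (u x))"
    by (intro integrableI_bounded) auto
qed

section \<open>Maximisers and stationary points of a partially maximised function\<close>

text \<open>The derivative, the functional \<open>inner D\<close>, vanishes at an extremum; it is
  tested on \<open>D\<close> itself.\<close>

lemma GDERIV_zero_at_local_extremum:
  fixes h :: "'a::real_inner \<Rightarrow> real"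
  assumes D: "GDERIV h x :> D"
    and ext: "(\<forall>\<^sub>F y in nhds x. h y \<le> h x) \<or> (\<forall>\<^sub>F y in nhds x. h x \<le> h y)"
  shows "D = 0"
proof -
  obtain S where "open S" "x \<in> S" "(\<forall>y\<in>S. h y \<le> h x) \<or> (\<forall>y\<in>S. h x \<le> h y)"
    using ext unfolding eventually_nhds by blast
  from fun_cong[OF differential_zero_maxmin[OF this(2,1) D[unfolded gderiv_def] this(3)], of D]
  have "inner D D = 0" .
  then show ?thesis by simp
qed

text \<open>The difference \<open>h - k\<close> has a local maximum at \<open>x\<close>, so its
  gradient \<open>D - 0\<close> vanishes.\<close>

lemma has_gradient_zero_if_touching_below:
  assumes h: "has_gradient h S x D" and k: "has_gradient k S x 0"
    and le: "\<And>y. y \<in> S \<Longrightarrow> h y \<le> k y" and eq: "h x = k x"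
  shows "has_gradient h S x 0"
proof -
  note gh = h[unfolded has_gradient_def] and gk = k[unfolded has_gradient_def]
  have S: "\<forall>\<^sub>F y in nhds x. y \<in> S"
    using gh by (auto intro: eventually_mono[OF eventually_nhds_in_open[OF open_interior]] dest: subsetD[OF interior_subset])
  from gh gk have "\<forall>\<^sub>F y in nhds x. \<bar>h y\<bar> \<noteq> \<infinity>" "\<forall>\<^sub>F y in nhds x. \<bar>k y\<bar> \<noteq> \<infinity>" by blast+
  \<comment> \<open>\<open>real_of_ereal\<close> sends infinite values to 0, so the inequality
    passes to the reals only because both functions are finite near \<open>x\<close>.\<close>
  with S have "\<forall>\<^sub>F y in nhds x. real_of_ereal (h y) - real_of_ereal (k y)
      \<le> real_of_ereal (h x) - real_of_ereal (k x)"
  proof eventually_elim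
    case (elim y)
    then show ?case using le[of y] eq by (cases "h y"; cases "k y") auto
  qed
  moreover have "GDERIV (\<lambda>y. real_of_ereal (h y) - real_of_ereal (k y)) x :> D - 0"
    using gh gk by (intro GDERIV_diff) auto
  ultimately have "D - 0 = 0"
    by (intro GDERIV_zero_at_local_extremum) auto
  with h show ?thesis by simp
qed

text \<open>The constant \<open>h x\<close> serves as the function touching \<open>h\<close> from
  above.\<close>

lemma has_gradient_zero_at_maximum:
  assumes h: "has_gradient h S x D" and max: "\<And>y. y \<in> S \<Longrightarrow> h y \<le> h x"
  shows "has_gradient h S x 0"
proof (rule has_gradient_zero_if_touching_below[OF h])
  have "\<bar>h x\<bar> \<noteq> \<infinity>"
    using h unfolding has_gradient_def by (auto dest: eventually_nhds_x_imp_x)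
  then show "has_gradient (\<lambda>_. h x) S x 0"
    using h GDERIV_const unfolding has_gradient_def by auto
qed (use max in auto)

text \<open>Both claims follow from the chain
  \<open>F l' r' \<le> L l' \<le> L l = F l (\<rho> l)\<close>. In the local case the neighbourhood
  is a cylinder that constrains only the first coordinate.\<close>

lemma maximisers_transfer:
  fixes F :: "'l::euclidean_space \<Rightarrow> 'r::euclidean_space \<Rightarrow> ereal"
  assumes bound: "\<And>l r. l \<in> \<Lambda> \<Longrightarrow> r \<in> R \<Longrightarrow> F l r \<le> L l"
    and attained: "\<And>l. l \<in> \<Lambda> \<Longrightarrow> F l (\<rho> l) = L l"
    and \<rho>: "\<And>l. l \<in> \<Lambda> \<Longrightarrow> \<rho> l \<in> R"
  shows "global_maximiser L \<Lambda> l \<Longrightarrow> global_maximiser (\<lambda>(l, r). F l r) (\<Lambda> \<times> R) (l, \<rho> l)"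
    and "local_maximiser L \<Lambda> l \<Longrightarrow> local_maximiser (\<lambda>(l, r). F l r) (\<Lambda> \<times> R) (l, \<rho> l)"
proof -
  show "global_maximiser (\<lambda>(l, r). F l r) (\<Lambda> \<times> R) (l, \<rho> l)" if "global_maximiser L \<Lambda> l"
    using that attained \<rho> unfolding global_maximiser_def
    by (auto intro: order_trans[OF bound])
  assume loc: "local_maximiser L \<Lambda> l"
  \<comment> \<open>The filter \<open>at l within \<Lambda>\<close> leaves out \<open>l\<close>
    itself; there the inequality is reflexivity.\<close>
  then obtain S where S: "open S" "l \<in> S" "\<And>y. y \<in> S \<Longrightarrow> y \<in> \<Lambda> \<Longrightarrow> L y \<le> L l"
    unfolding local_maximiser_def eventually_at_topological by (metis order_refl)
  show "local_maximiser (\<lambda>(l, r). F l r) (\<Lambda> \<times> R) (l, \<rho> l)"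
    unfolding local_maximiser_def eventually_at_topological
  proof (intro conjI exI[of _ "S \<times> UNIV"] ballI impI)
    fix z assume "z \<in> S \<times> (UNIV :: 'r set)" "z \<in> \<Lambda> \<times> R"
    then show "(case z of (l, r) \<Rightarrow> F l r) \<le> (case (l, \<rho> l) of (l, r) \<Rightarrow> F l r)"
      using S attained loc unfolding local_maximiser_def by (auto intro: order_trans[OF bound])
  qed (use S loc \<rho> in \<open>auto simp: local_maximiser_def intro: open_Times\<close>)
qed

section \<open>The slices of the joint density\<close>

text \<open>Everything that concerns a single \<lambda>, with \<open>qx\<close> in the role of
  \<open>q(X;\<lambda>)\<close>.\<close>

locale variational_factor =
  fixes MX :: "'x measure" and MT :: "'t measure"
    and f :: "'x \<Rightarrow> 't \<Rightarrow> 'y \<Rightarrow> real" and Y :: 'y and qx :: "'x \<Rightarrow> real"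
  assumes sigma_finite_MX: "sigma_finite_measure MX"
    and sigma_finite_MT: "sigma_finite_measure MT"
    and posterior: "unnormalised_posterior MX MT f Y"
    and qx_density: "probability_density MX qx"
    and qstar_exists: "qstar_exists MX MT f Y qx"
begin

sublocale MX: sigma_finite_measure MX by (rule sigma_finite_MX)
sublocale MT: sigma_finite_measure MT by (rule sigma_finite_MT)
sublocale XT: pair_sigma_finite MX MT ..

abbreviation QX :: "'x measure" where "QX \<equiv> density MX (\<lambda>x. ennreal (qx x))"
abbreviation w :: "'t \<Rightarrow> ennreal" where "w \<equiv> qstar_weight MX f Y qx"

definition Z :: real where "Z = enn2real (\<integral>\<^sup>+ t. w t \<partial>MT)"

lemma measurable_qx [measurable]: "qx \<in> borel_measurable MX"
  using qx_density by (simp add: probability_density_def)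

lemma measurable_f [measurable]: "(\<lambda>z. f (fst z) (snd z) Y) \<in> borel_measurable (MX \<Otimes>\<^sub>M MT)"
  using posterior by (simp add: unnormalised_posterior_def split_beta')

lemma measurable_f_slice [measurable]:
  "t \<in> space MT \<Longrightarrow> (\<lambda>x. f x t Y) \<in> borel_measurable MX"
  using measurable_compose[OF measurable_Pair2' measurable_f] by simp

lemma f_nonneg: "x \<in> space MX \<Longrightarrow> t \<in> space MT \<Longrightarrow> 0 \<le> f x t Y"
  using posterior by (simp add: unnormalised_posterior_def)

sublocale QX: prob_space QX
  using qx_density by (intro prob_spaceI) (simp add: probability_density_def emeasure_density)

lemma AE_qx_pos: "AE x in QX. 0 < qx x"
  using qx_density by (subst AE_density) (auto simp: probability_density_def)

lemma integral_f_finite: "(\<integral>\<^sup>+ t. \<integral>\<^sup>+ x. ennreal (f x t Y) \<partial>MX \<partial>MT) < \<infinity>"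
  using posterior XT.nn_integral_snd[of "\<lambda>z. ennreal (f (fst z) (snd z) Y)"]
  by (simp add: unnormalised_posterior_def)

lemma AE_integral_f_finite: "AE t in MT. (\<integral>\<^sup>+ x. ennreal (f x t Y) \<partial>MX) < \<infinity>"
proof -
  have "(\<lambda>t. \<integral>\<^sup>+ x. ennreal (f x t Y) \<partial>MX) \<in> borel_measurable MT"
    using measurable_pair_swap[OF measurable_f]
    by (intro MX.borel_measurable_nn_integral) (simp add: split_beta')
  from nn_integral_PInf_AE[OF this] integral_f_finite show ?thesis
    by (auto simp: less_top)
qed

lemma measurable_w [measurable]: "w \<in> borel_measurable MT"
proof -
  \<comment> \<open>The pair is swapped so that the variable to be integrated out comes
    second.\<close>
  have "(\<lambda>(t, x). f x t Y) \<in> borel_measurable (MT \<Otimes>\<^sub>M MX)"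
    using measurable_pair_swap[OF measurable_f] by (simp add: split_beta')
  then have [measurable]: "(\<lambda>(t, x). f x t Y) \<in> borel_measurable (MT \<Otimes>\<^sub>M QX)"
    by (subst measurable_cong_sets[OF sets_pair_measure_cong refl]) auto
  show ?thesis
    unfolding qstar_weight_def eexpectation_def by measurable
qed

lemma Z_pos: "0 < Z" and nn_integral_w: "(\<integral>\<^sup>+ t. w t \<partial>MT) = ennreal Z"
  using qstar_exists unfolding qstar_exists_def Z_def
  by (auto simp: enn2real_positive_iff less_top)

lemma AE_w_finite: "AE t in MT. w t < \<infinity>"
  using nn_integral_PInf_AE[OF measurable_w] nn_integral_w by (auto simp: less_top)

text \<open>Valid even where \<open>w t\<close> is \<open>\<infinity>\<close>: both sides are then
  0, because \<open>enn2real\<close> sends \<open>\<infinity>\<close> to 0.\<close>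

lemma qstar_eq: "qstar MX MT f Y qx t = enn2real (w t) / Z"
  unfolding qstar_def nn_integral_w
  by (cases "w t") (use Z_pos in \<open>auto simp: divide_ennreal ennreal_top_divide\<close>)

lemma probability_density_qstar: "probability_density MT (qstar MX MT f Y qx)"
proof -
  have "(\<integral>\<^sup>+ t. ennreal (enn2real (w t) / Z) \<partial>MT) = (\<integral>\<^sup>+ t. w t / ennreal Z \<partial>MT)"
  proof (intro nn_integral_cong_AE)
    show "AE t in MT. ennreal (enn2real (w t) / Z) = w t / ennreal Z"
      using AE_w_finite
    proof eventually_elim
      case (elim t)
      then show ?case by (cases "w t") (use Z_pos in \<open>auto simp: divide_ennreal\<close>)
    qed
  qed
  also have "\<dots> = 1"
    using Z_pos by (simp add: nn_integral_divide nn_integral_w divide_ennreal)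
  finally show ?thesis
    using Z_pos unfolding probability_density_def qstar_eq[abs_def] by auto
qed

text \<open>A positive and finite \<open>w t\<close> means that its exponent, the expectation of
  \<open>eln f\<close>, is finite.\<close>

lemma ln_f_slice:
  assumes t: "t \<in> space MT" and w: "0 < w t" "w t < \<infinity>"
  shows "AE x in QX. 0 < f x t Y" and "integrable QX (\<lambda>x. ln (f x t Y))"
    and "ln (enn2real (w t)) = (\<integral>x. ln (f x t Y) \<partial>QX)"
proof -
  let ?e = "eexpectation QX (\<lambda>x. eln (f x t Y))"
  have [measurable]: "(\<lambda>x. f x t Y) \<in> borel_measurable QX"
    using t by simp
  have "\<bar>?e\<bar> \<noteq> \<infinity>"
    using w unfolding qstar_weight_def by (cases ?e) auto
  note fin = eexpectation_eln_finite_imp[OF _ this]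
  show *: "AE x in QX. 0 < f x t Y" "integrable QX (\<lambda>x. ln (f x t Y))"
    by (rule fin, measurable)+
  show "ln (enn2real (w t)) = (\<integral>x. ln (f x t Y) \<partial>QX)"
    unfolding qstar_weight_def eexpectation_eln_eq_integral[OF *(2,1)] by simp
qed

lemma w_pos_if_integrable_ln:
  assumes "AE x in QX. 0 < f x t Y" "integrable QX (\<lambda>x. ln (f x t Y))"
  shows "0 < w t"
  unfolding qstar_weight_def eexpectation_eln_eq_integral[OF assms(2,1)] by simp

text \<open>Here \<open>w t\<close> may be 0, so the expectation of \<open>eln f\<close> may be
  \<open>-\<infinity>\<close> and only the positive part is under control.\<close>

lemma integrable_pos_part_ln_f:
  assumes t: "t \<in> space MT" and w: "w t < \<infinity>"
  shows "integrable QX (\<lambda>x. max 0 (ln (f x t Y)))"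
proof (rule integrableI_bounded)
  have "eexpectation QX (\<lambda>x. eln (f x t Y)) \<noteq> \<infinity>"
    using w by (auto simp: qstar_weight_def)
  then have "(\<integral>\<^sup>+ x. e2ennreal (eln (f x t Y)) \<partial>QX) < \<infinity>"
    by (rule positive_part_finite_if_eexpectation_neq_PInf)
  moreover have "(\<integral>\<^sup>+ x. ennreal (norm (max 0 (ln (f x t Y)))) \<partial>QX)
      = (\<integral>\<^sup>+ x. e2ennreal (eln (f x t Y)) \<partial>QX)"
  proof (intro nn_integral_cong)
    fix x assume "x \<in> space QX"
    \<comment> \<open>Where \<open>f\<close> vanishes, the convention \<open>ln 0 = 0\<close> agrees
      with the truncation of \<open>-\<infinity>\<close> to 0.\<close>
    then have "0 \<le> f x t Y" using f_nonneg t by simp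
    then show "ennreal (norm (max 0 (ln (f x t Y)))) = e2ennreal (eln (f x t Y))"
      by (cases "f x t Y = 0") (auto simp: e2ennreal_eln max_def ennreal_neg)
  qed
  ultimately show "(\<integral>\<^sup>+ x. ennreal (norm (max 0 (ln (f x t Y)))) \<partial>QX) < \<infinity>" by simp
qed (use t in simp)

text \<open>
  The negative part of \<open>ln qx\<close> is controlled by \<open>- ln q = ln (f / q) - ln f \<le> f / q - ln f\<close> on
  any single slice where \<open>ln f\<close> is integrable.
\<close>

lemma integrable_neg_part_ln_qx: "integrable QX (\<lambda>x. max 0 (- ln (qx x)))"
proof -
  \<comment> \<open>A good slice exists because \<open>w\<close> has positive integral
    \<open>Z\<close>: if there were none, \<open>w\<close> would vanish almost everywhere.\<close>
  have "\<not> (AE t in MT. w t = 0)"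
    using nn_integral_w Z_pos nn_integral_0_iff_AE[OF measurable_w] by auto
  moreover have "AE t in MT. w t = 0" if none: "\<And>t. \<lbrakk>t \<in> space MT; 0 < w t; w t < \<infinity>;
      (\<integral>\<^sup>+ x. ennreal (f x t Y) \<partial>MX) < \<infinity>\<rbrakk> \<Longrightarrow> False"
    using AE_w_finite AE_integral_f_finite AE_space
    by eventually_elim (use none in \<open>auto simp: zero_less_iff_neq_zero\<close>)
  ultimately obtain t where t [measurable]: "t \<in> space MT" and w: "0 < w t" "w t < \<infinity>"
    and fin: "(\<integral>\<^sup>+ x. ennreal (f x t Y) \<partial>MX) < \<infinity>"
    by blast
  note f = ln_f_slice[OF t w]
  have "(\<integral>\<^sup>+ x. ennreal (norm (f x t Y / qx x)) \<partial>QX)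
      = (\<integral>\<^sup>+ x. ennreal (qx x) * ennreal (norm (f x t Y / qx x)) \<partial>MX)"
    by (intro nn_integral_density) auto
  \<comment> \<open>The factor \<open>qx\<close> cancels where it is positive; where it is 0 the
    left side is 0, hence only an inequality.\<close>
  also have "\<dots> \<le> (\<integral>\<^sup>+ x. ennreal (f x t Y) \<partial>MX)"
  proof (intro nn_integral_mono)
    fix x assume x: "x \<in> space MX"
    then have "0 \<le> qx x" "0 \<le> f x t Y"
      using qx_density f_nonneg t by (auto simp: probability_density_def)
    then show "ennreal (qx x) * ennreal (norm (f x t Y / qx x)) \<le> ennreal (f x t Y)"
      by (cases "qx x = 0") (auto simp: ennreal_mult'[symmetric])
  qed
  finally have "integrable QX (\<lambda>x. f x t Y / qx x)"
    using fin by (intro integrableI_bounded) auto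
  then have "integrable QX (\<lambda>x. \<bar>f x t Y / qx x\<bar> + \<bar>ln (f x t Y)\<bar>)"
    using f(2) by (intro Bochner_Integration.integrable_add integrable_abs)
  then show ?thesis
  proof (rule Bochner_Integration.integrable_bound)
    show "AE x in QX. norm (max 0 (- ln (qx x))) \<le> norm (\<bar>f x t Y / qx x\<bar> + \<bar>ln (f x t Y)\<bar>)"
      using AE_qx_pos f(1)
    proof eventually_elim
      case (elim x)
      then have "ln (f x t Y) - ln (qx x) \<le> f x t Y / qx x"
        using ln_bound[of "f x t Y / qx x"] by (simp add: ln_div)
      then show ?case by (simp add: max_def abs_if)
    qed
  qed simp
qed

end

section \<open>Gibbs inequality for the lower bound\<close>

text \<open>The density \<open>qt\<close> is arbitrary, so that the locale can serve both a
  competitor and the optimal density.\<close>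

locale variational_factor_pair = variational_factor MX MT f Y qx
  for MX :: "'x measure" and MT :: "'t measure"
    and f :: "'x \<Rightarrow> 't \<Rightarrow> 'y \<Rightarrow> real" and Y :: 'y and qx :: "'x \<Rightarrow> real" +
  fixes qt :: "'t \<Rightarrow> real"
  assumes qt_density: "probability_density MT qt"
begin

abbreviation QT :: "'t measure" where "QT \<equiv> density MT (\<lambda>t. ennreal (qt t))"
abbreviation ratio :: "'x \<Rightarrow> 't \<Rightarrow> real" where "ratio x t \<equiv> f x t Y / (qx x * qt t)"

lemma measurable_qt [measurable]: "qt \<in> borel_measurable MT"
  using qt_density by (simp add: probability_density_def)

sublocale QT: prob_space QT
  using qt_density by (intro prob_spaceI) (simp add: probability_density_def emeasure_density)

sublocale QXT: pair_sigma_finite QX QT ..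

lemma AE_qt_pos: "AE t in QT. 0 < qt t"
  using qt_density by (subst AE_density) (auto simp: probability_density_def)

lemma AE_QT_if_AE_MT: "AE t in MT. P t \<Longrightarrow> AE t in QT. P t"
  by (subst AE_density) auto

lemma QX_QT_eq_density:
  "QX \<Otimes>\<^sub>M QT = density (MX \<Otimes>\<^sub>M MT) (\<lambda>(x, t). ennreal (qx x) * ennreal (qt t))"
  by (intro pair_measure_density MT.sigma_finite_measure_axioms QT.sigma_finite_measure_axioms) auto

lemma measurable_ratio [measurable]: "case_prod ratio \<in> borel_measurable (QX \<Otimes>\<^sub>M QT)"
proof -
  have "case_prod ratio \<in> borel_measurable (MX \<Otimes>\<^sub>M MT)"
    by (simp add: split_beta')
  then show ?thesis
    by (simp add: QX_QT_eq_density)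
qed

text \<open>Needed to exchange the two almost-everywhere quantifiers over \<open>QX\<close> and
  \<open>QT\<close>.\<close>

lemma ratio_pos_sets:
  "{z \<in> space (QX \<Otimes>\<^sub>M QT). 0 < ratio (fst z) (snd z)} \<in> sets (QX \<Otimes>\<^sub>M QT)"
proof -
  have "{z \<in> space (QX \<Otimes>\<^sub>M QT). 0 < case_prod ratio z} \<in> sets (QX \<Otimes>\<^sub>M QT)"
    by measurable
  then show ?thesis by (simp only: split_beta')
qed

text \<open>The densities cancel against the denominator, leaving at most the integral of
  \<open>f\<close>, which is finite.\<close>

lemma integrable_ratio: "integrable (QX \<Otimes>\<^sub>M QT) (case_prod ratio)"
proof (rule integrableI_bounded)
  have "(\<integral>\<^sup>+ z. ennreal (norm (case_prod ratio z)) \<partial>(QX \<Otimes>\<^sub>M QT))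
      = (\<integral>\<^sup>+ z. (ennreal (qx (fst z)) * ennreal (qt (snd z)))
            * ennreal (norm (ratio (fst z) (snd z))) \<partial>(MX \<Otimes>\<^sub>M MT))"
    unfolding QX_QT_eq_density split_beta' by (intro nn_integral_density) auto
  also have "\<dots> \<le> (\<integral>\<^sup>+ z. ennreal (f (fst z) (snd z) Y) \<partial>(MX \<Otimes>\<^sub>M MT))"
  proof (intro nn_integral_mono)
    fix z assume "z \<in> space (MX \<Otimes>\<^sub>M MT)"
    then have "0 \<le> qx (fst z)" "0 \<le> qt (snd z)" "0 \<le> f (fst z) (snd z) Y"
      using qx_density qt_density f_nonneg
      by (auto simp: probability_density_def space_pair_measure)
    then show "(ennreal (qx (fst z)) * ennreal (qt (snd z)))
        * ennreal (norm (ratio (fst z) (snd z))) \<le> ennreal (f (fst z) (snd z) Y)"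
      by (cases "qx (fst z) = 0 \<or> qt (snd z) = 0") (auto simp: ennreal_mult'[symmetric])
  qed
  also have "\<dots> < \<infinity>"
    using posterior by (simp add: unnormalised_posterior_def)
  finally show "(\<integral>\<^sup>+ z. ennreal (norm (case_prod ratio z)) \<partial>(QX \<Otimes>\<^sub>M QT)) < \<infinity>" .
qed simp

lemma elbo_eq: "elbo MX MT f Y qx qt = eexpectation (QX \<Otimes>\<^sub>M QT) (\<lambda>z. eln (case_prod ratio z))"
  by (simp add: elbo_def split_beta')

lemma elbo_neq_PInf: "elbo MX MT f Y qx qt \<noteq> \<infinity>"
  unfolding elbo_eq
proof (rule eexpectation_neq_PInf)
  have "(\<integral>\<^sup>+ z. e2ennreal (eln (case_prod ratio z)) \<partial>(QX \<Otimes>\<^sub>M QT))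
      \<le> (\<integral>\<^sup>+ z. ennreal (norm (case_prod ratio z)) \<partial>(QX \<Otimes>\<^sub>M QT))"
    by (intro nn_integral_mono e2ennreal_eln_le)
  also have "\<dots> < \<infinity>"
    using integrable_ratio by (simp only: integrable_iff_bounded)
  finally show "(\<integral>\<^sup>+ z. e2ennreal (eln (case_prod ratio z)) \<partial>(QX \<Otimes>\<^sub>M QT)) < \<infinity>" .
qed

text \<open>The logarithm splits into three integrable terms; the mean of \<open>ln f\<close> is
  \<open>ln w\<close>, and \<open>ln (qt t)\<close> is constant under the probability measure
  \<open>QX\<close>.\<close>

lemma ln_ratio_slice:
  assumes t: "t \<in> space MT" "0 < qt t" and w: "0 < w t" "w t < \<infinity>"
    and int: "integrable QX (\<lambda>x. ln (qx x))"
  shows "AE x in QX. 0 < ratio x t"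
    and "integrable QX (\<lambda>x. ln (ratio x t))"
    and "(\<integral>x. ln (ratio x t) \<partial>QX) = ln (enn2real (w t)) - (\<integral>x. ln (qx x) \<partial>QX) - ln (qt t)"
proof -
  note f = ln_f_slice[OF t(1) w]
  show "AE x in QX. 0 < ratio x t"
    using AE_qx_pos f(1) by eventually_elim (use t in auto)
  have *: "AE x in QX. ln (ratio x t) = ln (f x t Y) - ln (qx x) - ln (qt t)"
    using AE_qx_pos f(1) by eventually_elim (use t in \<open>auto simp: ln_div ln_mult\<close>)
  have int': "integrable QX (\<lambda>x. ln (f x t Y) - ln (qx x) - ln (qt t))"
    using f(2) int by (intro Bochner_Integration.integrable_diff) auto
  show "integrable QX (\<lambda>x. ln (ratio x t))"
    using int' by (rule integrable_cong_AE_imp) (use * t in auto)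
  have "(\<integral>x. ln (ratio x t) \<partial>QX) = (\<integral>x. ln (f x t Y) - ln (qx x) - ln (qt t) \<partial>QX)"
    by (intro integral_cong_AE *) (use t in auto)
  then show "(\<integral>x. ln (ratio x t) \<partial>QX) = ln (enn2real (w t)) - (\<integral>x. ln (qx x) \<partial>QX) - ln (qt t)"
    using f int QX.prob_space by simp
qed

text \<open>The value \<open>\<infinity>\<close> being excluded, the bound is finite. Fubini is used
  with \<open>X\<close> innermost, since \<open>w\<close> comes from the expectation over
  \<open>X\<close>.\<close>

lemma finite_elbo_imp:
  assumes "elbo MX MT f Y qx qt \<noteq> - \<infinity>"
  shows "AE t in QT. AE x in QX. 0 < ratio x t"
    and "integrable (QX \<Otimes>\<^sub>M QT) (\<lambda>(x, t). ln (ratio x t))"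
    and "elbo MX MT f Y qx qt = ereal (\<integral>t. \<integral>x. ln (ratio x t) \<partial>QX \<partial>QT)"
proof -
  have fin: "\<bar>eexpectation (QX \<Otimes>\<^sub>M QT) (\<lambda>z. eln (case_prod ratio z))\<bar> \<noteq> \<infinity>"
    using assms elbo_neq_PInf unfolding elbo_eq by auto
  note * = eexpectation_eln_finite_imp[OF measurable_ratio fin]
  have "AE x in QX. AE t in QT. 0 < ratio x t"
    using QXT.AE_pair[OF *(1)] by simp
  then show "AE t in QT. AE x in QX. 0 < ratio x t"
    by (simp add: QXT.AE_commute[OF ratio_pos_sets])
  show int: "integrable (QX \<Otimes>\<^sub>M QT) (\<lambda>(x, t). ln (ratio x t))"
    using *(2) by (simp add: split_beta')
  show "elbo MX MT f Y qx qt = ereal (\<integral>t. \<integral>x. ln (ratio x t) \<partial>QX \<partial>QT)"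
    unfolding elbo_eq eexpectation_eln_eq_integral[OF *(2,1)] QXT.integral_snd[OF int]
    by (simp add: split_beta')
qed

text \<open>On one slice \<open>ln qx = ln f - ln ratio - ln qt\<close>, which bounds the positive
  part of \<open>ln qx\<close>; the negative part is
  \<open>integrable_neg_part_ln_qx\<close>.\<close>

lemma finite_elbo_imp_integrable_ln_qx:
  assumes fin: "elbo MX MT f Y qx qt \<noteq> - \<infinity>"
  shows "integrable QX (\<lambda>x. ln (qx x))"
proof -
  note e = finite_elbo_imp[OF fin]
  have "AE t in QT. t \<in> space MT \<and> 0 < qt t \<and> w t < \<infinity> \<and> (AE x in QX. 0 < ratio x t)
      \<and> integrable QX (\<lambda>x. ln (ratio x t))"
    using AE_space AE_qt_pos AE_QT_if_AE_MT[OF AE_w_finite] e(1) QXT.AE_integrable_snd[OF e(2)]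
    by eventually_elim auto
  \<comment> \<open>A property that holds almost everywhere for a probability measure has a
    witness.\<close>
  then obtain t where t [measurable]: "t \<in> space MT" and qt: "0 < qt t" and w: "w t < \<infinity>"
    and pos: "AE x in QX. 0 < ratio x t" and int: "integrable QX (\<lambda>x. ln (ratio x t))"
    using eventually_happens'[OF QT.ae_filter_bot] by blast
  have "integrable QX (\<lambda>x. \<bar>ln (ratio x t)\<bar> + max 0 (ln (f x t Y)) + \<bar>ln (qt t)\<bar>)"
    by (intro Bochner_Integration.integrable_add integrable_abs int integrable_pos_part_ln_f t w
        QX.integrable_const)
  then have "integrable QX (\<lambda>x. max 0 (ln (qx x)))"
  proof (rule Bochner_Integration.integrable_bound)
    show "AE x in QX. norm (max 0 (ln (qx x)))
        \<le> norm (\<bar>ln (ratio x t)\<bar> + max 0 (ln (f x t Y)) + \<bar>ln (qt t)\<bar>)"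
      using AE_qx_pos pos
    proof eventually_elim
      case (elim x)
      have "0 < f x t Y" by (rule pos_if_pos_divide[OF elim(2)]) (use elim(1) qt in simp)
      from ln_divide_mult[OF this elim(1) qt] show ?case
        unfolding real_norm_def by linarith
    qed
  qed simp
  then have "integrable QX (\<lambda>x. max 0 (ln (qx x)) - max 0 (- ln (qx x)))"
    using integrable_neg_part_ln_qx by (rule Bochner_Integration.integrable_diff)
  also have "(\<lambda>x. max 0 (ln (qx x)) - max 0 (- ln (qx x))) = (\<lambda>x. ln (qx x))"
    by (auto simp: max_def)
  finally show ?thesis .
qed

text \<open>Gibbs' inequality for \<open>qt\<close> against \<open>w / Z\<close>, applied to the inner integrals.\<close>

lemma elbo_le:
  assumes int: "integrable QX (\<lambda>x. ln (qx x))"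
  shows "elbo MX MT f Y qx qt \<le> ereal (ln Z - (\<integral>x. ln (qx x) \<partial>QX))"
proof (cases "elbo MX MT f Y qx qt = - \<infinity>")
  case False
  note e = finite_elbo_imp[OF False]
  \<comment> \<open>\<open>?v\<close> is the likelihood ratio of \<open>qstar\<close> to
    \<open>qt\<close>, and each inner integral will equal \<open>ln ?v + ?K\<close>.\<close>
  let ?K = "ln Z - (\<integral>x. ln (qx x) \<partial>QX)" and ?v = "\<lambda>t. enn2real (w t) / (Z * qt t)"
  have "(\<integral>\<^sup>+ t. ennreal (?v t) \<partial>QT) = (\<integral>\<^sup>+ t. ennreal (qt t) * ennreal (?v t) \<partial>MT)"
    by (intro nn_integral_density) auto
  \<comment> \<open>Only an inequality, as \<open>qt\<close> may vanish where \<open>qstar\<close>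
    does not.\<close>
  also have "\<dots> \<le> (\<integral>\<^sup>+ t. ennreal (qstar MX MT f Y qx t) \<partial>MT)"
  proof (intro nn_integral_mono)
    fix t assume "t \<in> space MT"
    then have "0 \<le> qt t" using qt_density by (simp add: probability_density_def)
    then show "ennreal (qt t) * ennreal (?v t) \<le> ennreal (qstar MX MT f Y qx t)"
      using Z_pos by (cases "qt t = 0") (auto simp: ennreal_mult'[symmetric] qstar_eq)
  qed
  also have "\<dots> = 1"
    using probability_density_qstar by (simp add: probability_density_def)
  finally have v: "(\<integral>\<^sup>+ t. ennreal (?v t) \<partial>QT) \<le> 1" .
  have v_nonneg: "AE t in QT. 0 \<le> ?v t"
    using AE_qt_pos by eventually_elim (use Z_pos in auto)
  have v_int: "integrable QT ?v"
    using v v_nonneg by (intro integrableI_nonneg) (auto intro: le_less_trans)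
  have "ennreal (\<integral>t. ?v t \<partial>QT) \<le> 1"
    using v nn_integral_eq_integral[OF v_int v_nonneg] by simp
  then have v_le: "(\<integral>t. ?v t \<partial>QT) \<le> 1"
    by (simp add: ennreal_le_1)
  have "(\<integral>t. \<integral>x. ln (ratio x t) \<partial>QX \<partial>QT) \<le> (\<integral>t. ?v t - 1 + ?K \<partial>QT)"
  proof (rule integral_mono_AE)
    show "AE t in QT. (\<integral>x. ln (ratio x t) \<partial>QX) \<le> ?v t - 1 + ?K"
      using AE_space AE_qt_pos AE_QT_if_AE_MT[OF AE_w_finite] e(1) QXT.AE_integrable_snd[OF e(2)]
    proof eventually_elim
      case (elim t)
      then have t [measurable]: "t \<in> space MT" by simp
      have pos: "AE x in QX. 0 < f x t Y"
        using AE_qx_pos elim(4)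
        by eventually_elim (use elim(2) in \<open>auto simp: zero_less_divide_iff mult_less_0_iff\<close>)
      \<comment> \<open>Adding the two logarithms back recovers \<open>ln f\<close>; its
        integrability rules out \<open>w t = 0\<close>, where \<open>ln ?v\<close> would be
        meaningless.\<close>
      have "integrable QX (\<lambda>x. ln (ratio x t) + ln (qx x) + ln (qt t))"
        using elim int by (intro Bochner_Integration.integrable_add) auto
      then have "integrable QX (\<lambda>x. ln (f x t Y))"
      proof (rule integrable_cong_AE_imp)
        show "AE x in QX. ln (ratio x t) + ln (qx x) + ln (qt t) = ln (f x t Y)"
          using AE_qx_pos pos by eventually_elim (use elim(2) in \<open>auto simp: ln_div ln_mult\<close>)
      qed simp
      with pos have w: "0 < w t" by (rule w_pos_if_integrable_ln)
      then have w': "0 < enn2real (w t)"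
        using elim(3) by (simp add: enn2real_positive_iff less_top)
      have "ln (?v t) \<le> ?v t - 1"
        using w' Z_pos elim(2) by (intro ln_le_minus_one) auto
      moreover have "ln (?v t) = ln (enn2real (w t)) - ln Z - ln (qt t)"
        using w' Z_pos elim(2) by (simp add: ln_div ln_mult)
      ultimately show ?case
        using ln_ratio_slice(3)[OF t elim(2) w elim(3) int] by simp
    qed
  qed (use QXT.integrable_snd[OF e(2)] v_int in auto)
  also have "\<dots> = (\<integral>t. ?v t \<partial>QT) - 1 + ?K"
    using v_int QT.prob_space by simp
  also have "\<dots> \<le> ?K" using v_le by simp
  finally show ?thesis using e(3) by simp
qed simp

text \<open>
  Integrability of \<open>ln ratio\<close> on the product: since \<open>ln u \<le> u\<close>, the absolute value is at most
  \<open>2 u - ln u\<close>, whose inner integrals are known and whose first summand is integrable.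
\<close>

lemma elbo_eq_if_optimal:
  assumes int: "integrable QX (\<lambda>x. ln (qx x))"
    and opt: "AE t in MT. qt t = qstar MX MT f Y qx t"
  shows "elbo MX MT f Y qx qt = ereal (ln Z - (\<integral>x. ln (qx x) \<partial>QX))"
proof -
  let ?K = "ln Z - (\<integral>x. ln (qx x) \<partial>QX)"
  \<comment> \<open>For the optimal density \<open>ln w - ln qt\<close> is the constant
    \<open>ln Z\<close>, so the inner integral does not depend on \<open>t\<close>.\<close>
  have slice: "AE t in QT. (AE x in QX. 0 < ratio x t) \<and> integrable QX (\<lambda>x. ln (ratio x t))
      \<and> (\<integral>x. ln (ratio x t) \<partial>QX) = ?K"
    using AE_space AE_qt_pos AE_QT_if_AE_MT[OF AE_w_finite] AE_QT_if_AE_MT[OF opt]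
  proof eventually_elim
    case (elim t)
    then have "0 < enn2real (w t)"
      using Z_pos by (simp add: qstar_eq zero_less_divide_iff)
    then have w: "0 < w t" by (simp add: enn2real_positive_iff)
    have "ln (qt t) = ln (enn2real (w t)) - ln Z"
      using \<open>0 < enn2real (w t)\<close> Z_pos elim by (simp add: qstar_eq ln_div)
    then show ?case
      using ln_ratio_slice[OF _ elim(2) w elim(3) int] elim(1) by simp
  qed
  have pos: "AE z in QX \<Otimes>\<^sub>M QT. 0 < case_prod ratio z"
  proof (rule QXT.AE_pair_measure)
    have "AE t in QT. AE x in QX. 0 < ratio x t"
      using slice by eventually_elim auto
    then show "AE x in QX. AE t in QT. 0 < case_prod ratio (x, t)"
      by (simp add: QXT.AE_commute[OF ratio_pos_sets])
  qed measurable
  have lnm [measurable]: "(\<lambda>z. ln (case_prod ratio z)) \<in> borel_measurable (QX \<Otimes>\<^sub>M QT)"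
    by measurable
  have u: "integrable QT (\<lambda>t. \<integral>x. ratio x t \<partial>QX)"
    by (rule QXT.integrable_snd[OF integrable_ratio])
  have "(\<integral>\<^sup>+ z. ennreal (norm (ln (case_prod ratio z))) \<partial>(QX \<Otimes>\<^sub>M QT))
      = (\<integral>\<^sup>+ t. \<integral>\<^sup>+ x. ennreal (norm (ln (ratio x t))) \<partial>QX \<partial>QT)"
    by (subst QXT.nn_integral_snd[symmetric]) auto
  also have "\<dots> \<le> (\<integral>\<^sup>+ t. ennreal (norm (2 * (\<integral>x. ratio x t \<partial>QX) - ?K)) \<partial>QT)"
  proof (rule nn_integral_mono_AE)
    show "AE t in QT. (\<integral>\<^sup>+ x. ennreal (norm (ln (ratio x t))) \<partial>QX)
        \<le> ennreal (norm (2 * (\<integral>x. ratio x t \<partial>QX) - ?K))"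
      using slice QXT.AE_integrable_snd[OF integrable_ratio]
    proof eventually_elim
      case (elim t)
      have "(\<integral>x. norm (ln (ratio x t)) \<partial>QX) \<le> (\<integral>x. 2 * ratio x t - ln (ratio x t) \<partial>QX)"
      proof (rule integral_mono_AE)
        from elim have "AE x in QX. 0 < ratio x t" by blast
        then show "AE x in QX. norm (ln (ratio x t)) \<le> 2 * ratio x t - ln (ratio x t)"
        proof eventually_elim
          case (elim x)
          then show ?case using ln_bound[of "ratio x t"] by (simp only: real_norm_def abs_if) auto
        qed
      qed (use elim in \<open>auto simp del: times_divide_eq_right
          intro!: Bochner_Integration.integrable_diff integrable_mult_right\<close>)
      also have "\<dots> = 2 * (\<integral>x. ratio x t \<partial>QX) - ?K"
        using elim by (simp del: times_divide_eq_right)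
      also have "\<dots> \<le> norm (2 * (\<integral>x. ratio x t \<partial>QX) - ?K)"
        by simp
      finally have "ennreal (\<integral>x. norm (ln (ratio x t)) \<partial>QX)
          \<le> ennreal (norm (2 * (\<integral>x. ratio x t \<partial>QX) - ?K))"
        by (rule ennreal_leI)
      also have "ennreal (\<integral>x. norm (ln (ratio x t)) \<partial>QX) = (\<integral>\<^sup>+ x. ennreal (norm (ln (ratio x t))) \<partial>QX)"
        using elim by (intro nn_integral_eq_integral[symmetric]) auto
      finally show ?case .
    qed
  qed
  also have "\<dots> < \<infinity>"
  proof -
    have "integrable QT (\<lambda>t. 2 * (\<integral>x. ratio x t \<partial>QX) - ?K)"
      using u by (intro Bochner_Integration.integrable_diff integrable_mult_right) auto
    then show ?thesis by (simp only: integrable_iff_bounded)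
  qed
  finally have ln_int: "integrable (QX \<Otimes>\<^sub>M QT) (\<lambda>z. ln (case_prod ratio z))"
    by (intro integrableI_bounded) auto
  then have ln_int': "integrable (QX \<Otimes>\<^sub>M QT) (\<lambda>(x, t). ln (ratio x t))"
    by (simp add: split_beta')
  have "(\<integral>z. ln (case_prod ratio z) \<partial>(QX \<Otimes>\<^sub>M QT)) = (\<integral>t. \<integral>x. ln (ratio x t) \<partial>QX \<partial>QT)"
    unfolding QXT.integral_snd[OF ln_int'] by (simp add: split_beta')
  also have "\<dots> = (\<integral>t. ?K \<partial>QT)"
    by (rule integral_cong_AE)
      (use slice QXT.integrable_snd[OF ln_int'] in \<open>auto elim: eventually_mono\<close>)
  also have "\<dots> = ?K" using QT.prob_space by simp
  finally show ?thesis
    unfolding elbo_eq eexpectation_eln_eq_integral[OF ln_int pos] by simp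
qed

end

section \<open>Comparison with the optimal density and transfer to the parameters\<close>

text \<open>If \<open>ln qx\<close> is integrable,
  \<open>ln Z - (\<integral>x. ln (qx x) \<partial>QX)\<close> lies between the two values;
  otherwise the left one is \<open>-\<infinity>\<close>.\<close>

lemma (in variational_factor) elbo_le_optimal:
  assumes p: "probability_density MT p" and q: "probability_density MT q"
    and opt: "AE t in MT. q t = qstar MX MT f Y qx t"
  shows "elbo MX MT f Y qx p \<le> elbo MX MT f Y qx q"
proof -
  interpret p: variational_factor_pair MX MT f Y qx p by unfold_locales (rule p)
  interpret q: variational_factor_pair MX MT f Y qx q by unfold_locales (rule q)
  show ?thesis
  proof (cases "integrable QX (\<lambda>x. ln (qx x))")
    case True
    then show ?thesis using p.elbo_le q.elbo_eq_if_optimal[OF _ opt] by simp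
  next
    case False
    then have "elbo MX MT f Y qx p = - \<infinity>" using p.finite_elbo_imp_integrable_ln_qx by blast
    then show ?thesis by simp
  qed
qed

theorem mainTheorem1:
  fixes MX :: "'x measure" and MT :: "'t measure"
    and f :: "'x \<Rightarrow> 't \<Rightarrow> 'y \<Rightarrow> real" and Y :: 'y
    and \<Lambda> :: "'l::euclidean_space set" and R :: "'r::euclidean_space set"
    and qX :: "'l \<Rightarrow> 'x \<Rightarrow> real" and qT :: "'r \<Rightarrow> 't \<Rightarrow> real"
    and \<rho>star :: "'l \<Rightarrow> 'r" and lstar :: 'l
  defines "F \<equiv> fixed_form_elbo MX MT f Y qX qT"
    and "L \<equiv> lm_elbo MX MT f Y qX"
  assumes "sigma_finite_measure MX" and "sigma_finite_measure MT"
    and "unnormalised_posterior MX MT f Y"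
    and "\<And>l. l \<in> \<Lambda> \<Longrightarrow> probability_density MX (qX l)"
    and "\<And>r. r \<in> R \<Longrightarrow> probability_density MT (qT r)"
    and "\<And>l. l \<in> \<Lambda> \<Longrightarrow> qstar_exists MX MT f Y (qX l)"
    and "\<And>l. l \<in> \<Lambda> \<Longrightarrow> \<rho>star l \<in> R"
    and "\<And>l. l \<in> \<Lambda> \<Longrightarrow> AE t in MT. qT (\<rho>star l) t = qstar MX MT f Y (qX l) t"
  shows "(global_maximiser L \<Lambda> lstar \<longrightarrow>
            global_maximiser (\<lambda>(l, r). F l r) (\<Lambda> \<times> R) (lstar, \<rho>star lstar))
       \<and> (local_maximiser L \<Lambda> lstar \<longrightarrow>
            local_maximiser (\<lambda>(l, r). F l r) (\<Lambda> \<times> R) (lstar, \<rho>star lstar))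
       \<and> ((\<exists>D. has_gradient (\<lambda>l. F l (\<rho>star lstar)) \<Lambda> lstar D) \<longrightarrow>
          (\<exists>D. has_gradient (\<lambda>r. F lstar r) R (\<rho>star lstar) D) \<longrightarrow>
          has_gradient L \<Lambda> lstar 0 \<longrightarrow>
            has_gradient (\<lambda>l. F l (\<rho>star lstar)) \<Lambda> lstar 0 \<and>
            has_gradient (\<lambda>r. F lstar r) R (\<rho>star lstar) 0)"
proof -
  have factor: "variational_factor MX MT f Y (qX l)" if "l \<in> \<Lambda>" for l
    using assms that by (simp add: variational_factor_def)
  have bound: "F l r \<le> L l" if "l \<in> \<Lambda>" "r \<in> R" for l r
    unfolding F_def L_def fixed_form_elbo_def lm_elbo_def
    using that assms variational_factor.probability_density_qstar[OF factor]
    by (intro variational_factor.elbo_le_optimal[OF factor]) auto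
  have attained: "F l (\<rho>star l) = L l" if "l \<in> \<Lambda>" for l
  proof (rule antisym)
    \<comment> \<open>The roles are reversed: \<open>qstar\<close> is now the competitor, and
      \<open>qT (\<rho>star l)\<close>, equal to it almost everywhere, is the optimum.\<close>
    show "L l \<le> F l (\<rho>star l)"
      unfolding F_def L_def fixed_form_elbo_def lm_elbo_def
      using that assms variational_factor.probability_density_qstar[OF factor]
      by (intro variational_factor.elbo_le_optimal[OF factor]) auto
  qed (use that assms bound in auto)
  have "has_gradient (\<lambda>l. F l (\<rho>star lstar)) \<Lambda> lstar 0 \<and> has_gradient (\<lambda>r. F lstar r) R (\<rho>star lstar) 0"
    if D: "has_gradient (\<lambda>l. F l (\<rho>star lstar)) \<Lambda> lstar D"
      "has_gradient (\<lambda>r. F lstar r) R (\<rho>star lstar) D'" and L: "has_gradient L \<Lambda> lstar 0" for D D'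
  proof -
    have l: "lstar \<in> \<Lambda>"
      using L interior_subset by (auto simp: has_gradient_def)
    then have r: "\<rho>star lstar \<in> R" by (rule assms)
    \<comment> \<open>In \<lambda>, the slice of \<open>F\<close> touches \<open>L\<close> from
      below at \<open>lstar\<close>; in \<rho>, the slice is at most \<open>L lstar\<close>, its
      value at \<open>\<rho>star lstar\<close>.\<close>
    show ?thesis
      using l r bound attained
      by (intro conjI has_gradient_zero_if_touching_below[OF D(1) L]
          has_gradient_zero_at_maximum[OF D(2)]) auto
  qed
  moreover note maximisers_transfer[of \<Lambda> R F L \<rho>star lstar, OF bound attained assms(9)]
  ultimately show ?thesis by blast
qed

end
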